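(* Let $p\equiv 3\pmod 4$ be a prime and $t\ge 1$ an integer. The Peisert graph $P^*(p^{2t})$ is triply transitive only when $(p,t)=(3,1)$.
   Context: With $\zeta$ a primitive element of $\mathbb F_{p^{2t}}$, the Peisert graph $P^*(p^{2t})$ has vertex set $\mathbb F_{p^{2t}}$, with $x\sim y$ iff $y-x=\zeta^i$ for some $i\equiv 0$ or $1\pmod 4$. For a strongly regular graph $\Gamma=(V,E)$: $A_0=I$, $A_1$ its adjacency matrix, $A_2=J-I-A_1$; for a vertex $\omega$, $E^*_{i,\omega}$ ($i=0,1,2$) is the diagonal matrix whose diagonal is the $\omega$-row of $A_i$; $T_\omega$ is the algebra generated by $A_0,A_1,A_2,E^*_{0,\omega},E^*_{1,\omega},E^*_{2,\omega}$; $T_{0,\omega}$ is the span of all $E^*_{i,\omega}A_jE^*_{k,\omega}$; $\tilde T_\omega$ is the algebra of complex matrices commuting with the permutation matrices of the stabilizer $G_\omega$ in $G=\mathrm{Aut}(\Gamma)$. $\Gamma$ is triply transitive if $G$ is transitive and $T_{0,\omega}=T_\omega=\tilde T_\omega$ for some (equivalently every) vertex $\omega$. *)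

theory Defs
  imports "HOL-Analysis.Analysis" "HOL-Number_Theory.Cong"
begin

definition primitive_element :: "'a::{field,finite} \<Rightarrow> bool" where
  "primitive_element \<zeta> \<longleftrightarrow> range (\<lambda>i::nat. \<zeta> ^ i) = UNIV - {0}"

text \<open>A graph is given by its adjacency relation; the vertex set is the whole (finite) type.
  If 4 divides the multiplicative order of \<open>\<zeta>\<close>, as it does for \<open>\<zeta>\<close> primitive in a field of
  order an even power of an odd prime, then the class of \<open>i\<close> modulo 4 is determined by
  \<open>\<zeta> ^ i\<close>.\<close>

definition peisert_graph :: "'a::{field,finite} \<Rightarrow> 'a \<Rightarrow> 'a \<Rightarrow> bool" where
  "peisert_graph \<zeta> x y \<longleftrightarrow>
     (\<exists>i::nat. ([i = 0] (mod 4) \<or> [i = 1] (mod 4)) \<and> y - x = \<zeta> ^ i)"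

definition automorphisms :: "('v \<Rightarrow> 'v \<Rightarrow> bool) \<Rightarrow> ('v \<Rightarrow> 'v) set" where
  "automorphisms E = {g. bij g \<and> (\<forall>x y. E (g x) (g y) \<longleftrightarrow> E x y)}"

definition vertex_transitive :: "('v \<Rightarrow> 'v \<Rightarrow> bool) \<Rightarrow> bool" where
  "vertex_transitive E \<longleftrightarrow> (\<forall>x y. \<exists>g\<in>automorphisms E. g x = y)"

text \<open>\<^const>\<open>span\<close> is the real span, so complex subspaces of matrices need their own
  interpretation.\<close>

interpretation cmat: vector_space
  "\<lambda>(c::complex) (M::complex^'n::finite^'m::finite). map_matrix ((*) c) M"
  by unfold_locales (simp_all add: vec_eq_iff distrib_left distrib_right)

definition generated_algebra :: "(complex^'n^'n) set \<Rightarrow> (complex^'n::finite^'n) set" where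
  "generated_algebra S =
     (\<lambda>U. cmat.subspace U \<and> (\<forall>M\<in>U. \<forall>N\<in>U. M ** N \<in> U)) hull S"

definition adjacency_matrix :: "('v \<Rightarrow> 'v \<Rightarrow> bool) \<Rightarrow> complex^'v^'v" where
  "adjacency_matrix E = (\<chi> x y. if E x y then 1 else 0)"

text \<open>The matrices \<open>A\<^sub>0 = I\<close>, \<open>A\<^sub>1\<close>, \<open>A\<^sub>2 = J - I - A\<^sub>1\<close>; only the indices \<open>i \<le> 2\<close> are meaningful.\<close>

definition relation_matrix :: "('v \<Rightarrow> 'v \<Rightarrow> bool) \<Rightarrow> nat \<Rightarrow> complex^'v::finite^'v" where
  "relation_matrix E i =
     (if i = 0 then mat 1
      else if i = 1 then adjacency_matrix E
      else (\<chi> x y. 1) - mat 1 - adjacency_matrix E)"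

definition dual_idempotent :: "('v \<Rightarrow> 'v \<Rightarrow> bool) \<Rightarrow> 'v \<Rightarrow> nat \<Rightarrow> complex^'v::finite^'v" where
  "dual_idempotent E \<omega> i = (\<chi> x y. if x = y then relation_matrix E i $ \<omega> $ x else 0)"

definition terwilliger_algebra :: "('v \<Rightarrow> 'v \<Rightarrow> bool) \<Rightarrow> 'v \<Rightarrow> (complex^'v::finite^'v) set" where
  "terwilliger_algebra E \<omega> =
     generated_algebra (relation_matrix E ` {0..2} \<union> dual_idempotent E \<omega> ` {0..2})"

definition terwilliger_T0 :: "('v \<Rightarrow> 'v \<Rightarrow> bool) \<Rightarrow> 'v \<Rightarrow> (complex^'v::finite^'v) set" where
  "terwilliger_T0 E \<omega> =
     cmat.span {dual_idempotent E \<omega> i ** relation_matrix E j ** dual_idempotent E \<omega> k | i j k.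
                  i \<in> {0..2} \<and> j \<in> {0..2} \<and> k \<in> {0..2}}"

definition permutation_matrix :: "('v \<Rightarrow> 'v) \<Rightarrow> complex^'v^'v" where
  "permutation_matrix g = (\<chi> x y. if x = g y then 1 else 0)"

definition stabilizer_centralizer :: "('v \<Rightarrow> 'v \<Rightarrow> bool) \<Rightarrow> 'v \<Rightarrow> (complex^'v::finite^'v) set" where
  "stabilizer_centralizer E \<omega> =
     {M. \<forall>g\<in>automorphisms E. g \<omega> = \<omega> \<longrightarrow>
           M ** permutation_matrix g = permutation_matrix g ** M}"

text \<open>The notion is meant for strongly regular graphs, such as the Peisert graphs; strong
  regularity itself plays no role in the formula and is not part of the definition.\<close>

definition triply_transitive :: "('v::finite \<Rightarrow> 'v \<Rightarrow> bool) \<Rightarrow> bool" where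
  "triply_transitive E \<longleftrightarrow>
     vertex_transitive E \<and>
     (\<exists>\<omega>. terwilliger_T0 E \<omega> = terwilliger_algebra E \<omega> \<and>
          terwilliger_algebra E \<omega> = stabilizer_centralizer E \<omega>)"

end

theory Submission
  imports Defs
begin

text \<open>If \<open>T\<^sub>0 = T\<close> at \<open>\<omega>\<close>, then \<open>A\<^sub>1 E\<^sup>*\<^sub>1 A\<^sub>1\<close> lies in \<open>T\<^sub>0\<close>, which says that
  the number of common neighbours of \<open>x\<close> and \<open>y\<close> that are adjacent to
  \<open>\<omega>\<close> depends only on the mutual relations of \<open>\<omega>\<close>, \<open>x\<close>, \<open>y\<close>. Multiplication by \<open>\<zeta>\<^sup>2\<close> maps the graph
  to its complement, so it has the parameters \<open>(4\<mu>+1, 2\<mu>, \<mu>-1, \<mu>)\<close>, and the neighbourhood of \<open>\<omega>\<close>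
  induces a strongly regular graph on \<open>2\<mu>\<close> vertices of valency \<open>\<mu>-1\<close>. If adjacent vertices have \<open>e\<close>
  and nonadjacent ones \<open>c\<close> common neighbours in it, then \<open>(\<mu>-1)(\<mu>-2-e) = \<mu>c\<close>. Hence \<open>\<mu>\<close> divides
  \<open>\<mu>-2-e\<close>, so \<open>e = \<mu>-2\<close>, and the neighbourhood is a union of \<open>\<mu>\<close>-cliques. The \<open>\<mu>\<close> vertices of such a
  clique have pairwise disjoint sets of \<open>\<mu>\<close> neighbours among the \<open>2\<mu>\<close> vertices not adjacent to
  \<open>\<omega>\<close>. Therefore \<open>\<mu> \<le> 2\<close> and \<open>p\<^sup>2\<^sup>t \<le> 9\<close>.\<close>

text \<open>A vacuous \<open>P\<close> is covered too, so the constants \<open>e\<close> and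
  \<open>c\<close> of the local graph at \<omega> are obtained without first exhibiting suitable
  pairs of its vertices.\<close>

lemma constant_on_pairs:
  assumes "\<And>x y x' y'. P x y \<Longrightarrow> P x' y' \<Longrightarrow> f x y = f x' y'"
  shows "\<exists>c. \<forall>x y. P x y \<longrightarrow> f x y = c"
proof (cases "\<exists>a b. P a b")
  case True
  then obtain a b where "P a b" by blast
  with assms show ?thesis by (intro exI[of _ "f a b"]) blast
qed simp

section \<open>Triple counts from the equality of \<open>terwilliger_T0\<close> and
  \<open>terwilliger_algebra\<close>\<close>

lemma generated_algebra_superset: "S \<subseteq> generated_algebra S"
  unfolding generated_algebra_def by (rule hull_subset)

lemma generated_algebra_mult:
  assumes "M \<in> generated_algebra S" "N \<in> generated_algebra S"
  shows "M ** N \<in> generated_algebra S"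
  using assms unfolding generated_algebra_def hull_def by auto

text \<open>For irreflexive \<open>E\<close> this says that both pairs lie in the same one of the
  relations identity, adjacency, non-adjacency. In this form the entries of all relation matrices
  agree for an arbitrary \<open>E\<close>.\<close>

definition same_type :: "('v \<Rightarrow> 'v \<Rightarrow> bool) \<Rightarrow> 'v \<Rightarrow> 'v \<Rightarrow> 'v \<Rightarrow> 'v \<Rightarrow> bool" where
  "same_type E x y x' y' \<longleftrightarrow> (x = y \<longleftrightarrow> x' = y') \<and> (E x y \<longleftrightarrow> E x' y')"

lemma relation_matrix_same_type:
  assumes "same_type E x y x' y'"
  shows "relation_matrix E i $ x $ y = relation_matrix E i $ x' $ y'"
  using assms by (simp add: same_type_def relation_matrix_def adjacency_matrix_def mat_def)

lemma dual_idempotent_mult_left: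
  "(dual_idempotent E \<omega> i ** M) $ x $ y = relation_matrix E i $ \<omega> $ x * M $ x $ y"
  by (simp add: matrix_matrix_mult_def dual_idempotent_def if_distrib if_distribR
      cong: if_cong)

lemma dual_idempotent_mult_right:
  "(M ** dual_idempotent E \<omega> i) $ x $ y = M $ x $ y * relation_matrix E i $ \<omega> $ y"
  by (simp add: matrix_matrix_mult_def dual_idempotent_def if_distrib if_distribR
      cong: if_cong)

text \<open>The (x,y) entry of a spanning matrix is the product of the entries of three relation
  matrices at (\<omega>,x), (x,y) and (\<omega>,y), and equality of two fixed entries is a linear
  condition.\<close>

lemma terwilliger_T0_same_type:
  assumes "M \<in> terwilliger_T0 E \<omega>"
    and "same_type E \<omega> x \<omega> x'" "same_type E \<omega> y \<omega> y'" "same_type E x y x' y'"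
  shows "M $ x $ y = M $ x' $ y'"
proof -
  let ?W = "{M :: complex^'a^'a. M $ x $ y = M $ x' $ y'}"
  have "cmat.subspace ?W"
    by (auto simp: cmat.subspace_def)
  moreover have "dual_idempotent E \<omega> i ** relation_matrix E j ** dual_idempotent E \<omega> k \<in> ?W"
    for i j k
    using assms(2-4)
    by (simp add: dual_idempotent_mult_left dual_idempotent_mult_right
        relation_matrix_same_type[of E \<omega> x \<omega> x'] relation_matrix_same_type[of E \<omega> y \<omega> y']
        relation_matrix_same_type[of E x y x' y'])
  ultimately have "terwilliger_T0 E \<omega> \<subseteq> ?W"
    unfolding terwilliger_T0_def by (intro cmat.span_minimal) auto
  with assms(1) show ?thesis by auto
qed

lemma triple_count_same_type:
  assumes "terwilliger_T0 E \<omega> = terwilliger_algebra E \<omega>"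
    and "same_type E \<omega> x \<omega> x'" "same_type E \<omega> y \<omega> y'" "same_type E x y x' y'"
  shows "card {z. E x z \<and> E \<omega> z \<and> E z y} = card {z. E x' z \<and> E \<omega> z \<and> E z y'}"
proof -
  let ?A = "relation_matrix E 1" and ?D = "dual_idempotent E \<omega> 1"
  have gen: "?A \<in> terwilliger_algebra E \<omega>" "?D \<in> terwilliger_algebra E \<omega>"
    unfolding terwilliger_algebra_def
    by (auto intro!: subsetD[OF generated_algebra_superset])
  then have mem: "?A ** (?D ** ?A) \<in> terwilliger_T0 E \<omega>"
    unfolding assms(1) terwilliger_algebra_def by (intro generated_algebra_mult)
  have entry: "(?A ** (?D ** ?A)) $ a $ b = of_nat (card {z. E a z \<and> E \<omega> z \<and> E z b})" for a b
  proof -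
    have "(?A ** (?D ** ?A)) $ a $ b = (\<Sum>z\<in>UNIV. ?A $ a $ z * (?D ** ?A) $ z $ b)"
      by (simp add: matrix_matrix_mult_def)
    also have "\<dots> = (\<Sum>z\<in>UNIV. if E a z \<and> E \<omega> z \<and> E z b then 1 else 0)"
      by (intro sum.cong)
        (auto simp: dual_idempotent_mult_left relation_matrix_def adjacency_matrix_def)
    also have "\<dots> = of_nat (card {z. E a z \<and> E \<omega> z \<and> E z b})"
      by (simp flip: sum.inter_filter)
    finally show ?thesis .
  qed
  from terwilliger_T0_same_type[OF mem assms(2-4)] show ?thesis
    unfolding entry by simp
qed

section \<open>The neighbourhood of a vertex in a conference graph\<close>

text \<open>Here \<open>l\<close> is \<mu> - 1, so that \<open>Suc l\<close> is \<mu> and the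
  parameters are free of subtraction.\<close>

lemma conference_graph_locally_regular:
  fixes E :: "'v::finite \<Rightarrow> 'v \<Rightarrow> bool"
  assumes sym: "\<And>x y. E x y \<Longrightarrow> E y x" and irr: "\<And>x. \<not> E x x"
    and card: "CARD('v) = 4 * l + 5"
    and reg: "\<And>x. card {z. E x z} = 2 * l + 2"
    and lam: "\<And>x y. E x y \<Longrightarrow> card {z. E x z \<and> E y z} = l"
    and adj: "\<And>x y. E \<omega> x \<Longrightarrow> E \<omega> y \<Longrightarrow> E x y \<Longrightarrow> card {z. E x z \<and> E \<omega> z \<and> E z y} = e"
    and nonadj: "\<And>x y. E \<omega> x \<Longrightarrow> E \<omega> y \<Longrightarrow> x \<noteq> y \<Longrightarrow> \<not> E x y \<Longrightarrow>
      card {z. E x z \<and> E \<omega> z \<and> E z y} = c"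
  shows "l \<le> 1"
proof (cases "l = 0")
  case False
  have comm: "E x y \<longleftrightarrow> E y x" for x y using sym by blast
  define D where "D = {z. E \<omega> z}"
  have "card D = 2 * l + 2" using reg[of \<omega>] by (simp add: D_def)
  then obtain x where x: "x \<in> D" by fastforce
  define L where "L = {y \<in> D. E x y}"
  have cardL: "card L = l"
    using lam[of \<omega> x] x by (simp add: L_def D_def)
  have e: "card {z \<in> L. E z y} = e" if "y \<in> L" for y
  proof -
    have "{z \<in> L. E z y} = {z. E x z \<and> E \<omega> z \<and> E z y}" by (auto simp: L_def D_def)
    then show ?thesis using adj[of x y] that x by (auto simp: L_def D_def)
  qed
  obtain y0 where y0: "y0 \<in> L" using cardL False by fastforce
  have "{z \<in> L. E z y0} \<subseteq> L - {y0}" using irr by auto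
  then have "card {z \<in> L. E z y0} \<le> card (L - {y0})" by (intro card_mono) auto
  then have e_le: "Suc e \<le> l" using e[OF y0] cardL y0 False by simp
  \<comment> \<open>Double counting of the adjacent pairs of some z in \<open>L\<close> and y in
    \<open>D\<close>. Each z has \<open>l\<close> neighbours in \<open>D\<close>. On the other side,
    \<open>x\<close> contributes \<open>l\<close>, each vertex of \<open>L\<close> contributes
    \<open>e\<close>, and each of the remaining \<open>Suc l\<close> vertices of \<open>D\<close>
    contributes \<open>c\<close>.\<close>
  have eq: "l * l = l + l * e + Suc l * c"
  proof -
    have cnt: "card {y \<in> D. E z y} = l" if "z \<in> L" for z
      using lam[of \<omega> z] that by (simp add: L_def D_def)
    have "l * l = (\<Sum>y\<in>D. card {z \<in> L. E z y})"
      using sum_multicount[of D L "\<lambda>y z. E z y" l] cnt cardL by simp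
    also have "\<dots> = (\<Sum>y\<in>insert x (L \<union> (D - insert x L)). card {z \<in> L. E z y})"
      using x by (intro sum.cong) (auto simp: L_def)
    also have "\<dots> = card {z \<in> L. E z x} + ((\<Sum>y\<in>L. card {z \<in> L. E z y})
      + (\<Sum>y\<in>D - insert x L. card {z \<in> L. E z y}))"
      using irr by (subst sum.insert) (auto simp: L_def intro!: sum.union_disjoint)
    also have "{z \<in> L. E z x} = L" using comm by (auto simp: L_def)
    also have "(\<Sum>y\<in>L. card {z \<in> L. E z y}) = l * e" using e cardL by simp
    also have "(\<Sum>y\<in>D - insert x L. card {z \<in> L. E z y}) = (\<Sum>y\<in>D - insert x L. c)"
    proof (rule sum.cong)
      fix y assume y: "y \<in> D - insert x L"
      have "{z \<in> L. E z y} = {z. E x z \<and> E \<omega> z \<and> E z y}" by (auto simp: L_def D_def)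
      then show "card {z \<in> L. E z y} = c"
        using nonadj[of x y] y x by (auto simp: L_def D_def)
    qed simp
    also have "\<dots> = Suc l * c"
    proof -
      have "card (insert x L) = Suc l" using irr cardL by (simp add: L_def)
      moreover have "insert x L \<subseteq> D" using x by (auto simp: L_def)
      ultimately have "card (D - insert x L) = Suc l"
        using \<open>card D = _\<close> by (simp add: card_Diff_subset)
      then show ?thesis by simp
    qed
    finally show ?thesis using cardL by simp
  qed
  have "e = l - 1"
  proof -
    \<comment> \<open>By \<open>e_le\<close> the subtraction is exact. As \<open>Suc l\<close> is
      coprime to \<open>l\<close>, it divides \<open>l - 1 - e\<close>, which is smaller than
      \<open>Suc l\<close>.\<close>
    have "l * (l - 1 - e) = Suc l * c"
      using eq e_le by (auto simp: le_iff_add algebra_simps)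
    then have "Suc l dvd l * (l - 1 - e)" by (metis dvd_triv_left)
    then have "Suc l dvd l - 1 - e"
      using coprime_Suc_left_nat coprime_dvd_mult_right_iff by blast
    then have "l - 1 - e = 0" using dvd_imp_le[of "Suc l" "l - 1 - e"] by linarith
    with e_le show ?thesis by simp
  qed
  have clique: "E z y" if "y \<in> L" "z \<in> L" "y \<noteq> z" for y z
  proof -
    \<comment> \<open>The vertex y has \<open>l - 1\<close> neighbours in \<open>L\<close>, which is
      the number of all other vertices of \<open>L\<close>.\<close>
    have "{z \<in> L. E z y} = L - {y}"
      using irr e[OF that(1)] cardL \<open>e = l - 1\<close> that(1) by (intro card_subset_eq) auto
    with that show ?thesis by auto
  qed
  define K where "K = insert x L"
  have KD: "K \<subseteq> D" and cardK: "card K = Suc l"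
    using x irr cardL by (auto simp: K_def L_def)
  have K_adj: "E y z" if "y \<in> K" "z \<in> K" "y \<noteq> z" for y z
  proof -
    have "E x w" if "w \<in> L" for w using that by (simp add: L_def)
    with that clique[of z y] sym[of x y] show ?thesis unfolding K_def by auto
  qed
  define P where "P y = {w. w \<noteq> \<omega> \<and> \<not> E \<omega> w \<and> E y w}" for y
  have cardP: "card (P y) = Suc l" if "y \<in> K" for y
  proof -
    have y: "E \<omega> y" using that KD by (auto simp: D_def)
    \<comment> \<open>The \<open>2 * l + 2\<close> neighbours of y are \<omega>, the
      \<open>l\<close> common ones with \<omega>, and \<open>P y\<close>.\<close>
    have "{w. E y w} = insert \<omega> ({z. E \<omega> z \<and> E y z} \<union> P y)"
      using sym[OF y] by (auto simp: P_def)
    moreover have "card (insert \<omega> ({z. E \<omega> z \<and> E y z} \<union> P y)) = Suc (l + card (P y))"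
      using irr lam[OF y] by (subst card_insert_disjoint)
        (auto simp: P_def intro!: card_Un_disjoint)
    ultimately show ?thesis using reg[of y] by simp
  qed
  have disj: "P y \<inter> P z = {}" if "y \<in> K" "z \<in> K" "y \<noteq> z" for y z
  proof -
    have yz: "E \<omega> y" "E \<omega> z" "E y z" using that KD K_adj by (auto simp: D_def)
    \<comment> \<open>The vertex \<omega> and the \<open>l - 1\<close> common neighbours inside
      \<open>D\<close> already account for all \<open>l\<close> common neighbours of y and z, so
      none is left for \<open>P y\<close> and \<open>P z\<close>.\<close>
    let ?C = "insert \<omega> {u. E y u \<and> E \<omega> u \<and> E u z}"
    have "card ?C = l"
      using adj[OF yz] \<open>e = l - 1\<close> irr False by simp
    then have "?C = {u. E y u \<and> E z u}"
      using lam[OF yz(3)] yz comm by (intro card_subset_eq) auto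
    then show ?thesis unfolding P_def by blast
  qed
  have "Suc l * Suc l = card (\<Union>y\<in>K. P y)"
    using disj cardP cardK by (subst card_UN_disjoint) auto
  also have "\<dots> \<le> card (- insert \<omega> D)"
    by (intro card_mono) (auto simp: P_def D_def)
  also have "\<dots> = Suc l * 2"
    using irr \<open>card D = _\<close> card by (simp add: Compl_eq_Diff_UNIV card_Diff_subset D_def)
  finally show ?thesis by (simp only: mult_le_cancel1) simp
qed simp

section \<open>Parameters of a self-complementary Cayley graph\<close>

text \<open>\<open>D\<close> is the connection set of a Cayley graph on the additive group, and
  multiplication by \<open>u\<close> interchanges \<open>D\<close> with the nonzero elements outside
  it. This carries the count for adjacent pairs over to nonadjacent ones, and a double count then
  determines the size of \<open>D\<close>.\<close>

lemma self_complementary_set_card: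
  fixes D :: "'a::{field,finite} set"
  assumes zero: "0 \<notin> D" and minus: "\<And>x. x \<in> D \<Longrightarrow> - x \<in> D" and "D \<noteq> {}"
    and u: "\<And>x. x \<noteq> 0 \<Longrightarrow> u * x \<in> D \<longleftrightarrow> x \<notin> D" and "u \<noteq> 0"
    and lam: "\<And>s. s \<in> D \<Longrightarrow> card {z \<in> D. z - s \<in> D} = l"
  shows "card D = 2 * l + 2" and "CARD('a) = 4 * l + 5"
proof -
  define D' where "D' = - insert 0 D"
  have uD: "(*) u ` D' = D"
  proof (intro equalityI subsetI)
    fix x assume "x \<in> D"
    then have "x = u * (x / u)" "x / u \<in> D'"
      using u[of "x / u"] zero \<open>u \<noteq> 0\<close> by (auto simp: D'_def)
    then show "x \<in> (*) u ` D'" by blast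
  qed (use u in \<open>auto simp: D'_def\<close>)
  have inj: "inj_on ((*) u) A" for A using \<open>u \<noteq> 0\<close> by (auto simp: inj_on_def)
  have cardD': "card D' = card D"
    using uD card_image[OF inj, of D'] by simp
  have UN: "UNIV = insert 0 (D \<union> D')" by (auto simp: D'_def)
  then have card: "CARD('a) = Suc (card D + card D')"
    using zero by (subst UN, subst card_insert_disjoint)
      (auto simp: D'_def intro!: card_Un_disjoint)
  have shift: "card {z. z - s \<in> D} = card D" for s
    by (rule bij_betw_same_card[of "\<lambda>z. z - s"], rule bij_betw_byWitness[of _ "\<lambda>z. z + s"]) auto
  \<comment> \<open>Common non-neighbours of the adjacent vertices 0 and s: the translate of
    \<open>D\<close> by s consists of 0, \<open>l\<close> elements of \<open>D\<close> and elements
    of \<open>D'\<close>, and removing the latter from \<open>D'\<close> leaves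
    \<open>Suc l\<close>.\<close>
  have both: "card {z \<in> D'. z - s \<in> D'} = Suc l" if s: "s \<in> D" for s
  proof -
    have "{z. z - s \<in> D} = insert 0 ({z \<in> D. z - s \<in> D} \<union> {z \<in> D'. z - s \<in> D})"
      using minus[OF s] by (auto simp: D'_def)
    moreover have "card \<dots> = Suc (l + card {z \<in> D'. z - s \<in> D})"
      using zero lam[OF s] by (subst card_insert_disjoint)
        (auto simp: D'_def intro!: card_Un_disjoint)
    ultimately have 1: "card D = Suc (l + card {z \<in> D'. z - s \<in> D})"
      using shift by metis
    have "card D' = card ({z \<in> D'. z - s \<in> D} \<union> {z \<in> D'. z - s \<in> D'})"
      using s by (intro arg_cong[of _ _ card]) (auto simp: D'_def)
    also have "\<dots> = card {z \<in> D'. z - s \<in> D} + card {z \<in> D'. z - s \<in> D'}"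
      by (auto simp: D'_def intro!: card_Un_disjoint)
    finally show ?thesis using 1 cardD' by simp
  qed
  \<comment> \<open>Division by \<open>u\<close> turns common neighbours of 0 and s into common
    non-neighbours of 0 and \<open>s / u\<close>, which are adjacent, so \<open>both\<close>
    applies.\<close>
  have mu: "card {z \<in> D. z - s \<in> D} = Suc l" if s: "s \<in> D'" for s
  proof -
    have D'_iff: "u * x \<in> D \<longleftrightarrow> x \<in> D'" for x
      using u[of x] zero by (cases "x = 0") (auto simp: D'_def)
    have su: "s / u \<in> D"
      using u[of "s / u"] s \<open>u \<noteq> 0\<close> by (auto simp: D'_def)
    have "{z \<in> D. z - s \<in> D} = (*) u ` {z \<in> D'. z - s / u \<in> D'}"
    proof (intro equalityI subsetI)
      fix z assume z: "z \<in> {z \<in> D. z - s \<in> D}"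
      moreover have "u * (z / u - s / u) = z - s" using \<open>u \<noteq> 0\<close> by (simp add: algebra_simps)
      ultimately have "z / u \<in> {z \<in> D'. z - s / u \<in> D'}"
        using D'_iff[of "z / u"] D'_iff[of "z / u - s / u"] \<open>u \<noteq> 0\<close> by auto
      moreover have "z = u * (z / u)" using \<open>u \<noteq> 0\<close> by simp
      ultimately show "z \<in> (*) u ` {z \<in> D'. z - s / u \<in> D'}" by blast
    next
      fix z assume "z \<in> (*) u ` {z \<in> D'. z - s / u \<in> D'}"
      then obtain w where "z = u * w" "w \<in> D'" "w - s / u \<in> D'" by auto
      moreover have "u * (w - s / u) = u * w - s" using \<open>u \<noteq> 0\<close> by (simp add: algebra_simps)
      ultimately show "z \<in> {z \<in> D. z - s \<in> D}"
        using D'_iff[of w] D'_iff[of "w - s / u"] by auto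
    qed
    then show ?thesis using both[OF su] card_image[OF inj] by simp
  qed
  have shift': "card {s. z - s \<in> D} = card D" for z
    by (rule bij_betw_same_card[of "\<lambda>s. z - s"], rule bij_betw_byWitness[of _ "\<lambda>s. z - s"]) auto
  \<comment> \<open>Pairs (s,z) with z and z - s in \<open>D\<close> are counted in two ways. For
    fixed s there are \<open>card D\<close> of them if s = 0, \<open>l\<close> if s is in
    \<open>D\<close>, and \<open>Suc l\<close> if s is in \<open>D'\<close>.\<close>
  have "card D * card D = (\<Sum>s\<in>UNIV. card {z \<in> D. z - s \<in> D})"
    using sum_multicount[of UNIV D "\<lambda>s z. z - s \<in> D" "card D"] shift' by simp
  also have "\<dots> = card D + ((\<Sum>s\<in>D. card {z \<in> D. z - s \<in> D}) + (\<Sum>s\<in>D'. card {z \<in> D. z - s \<in> D}))"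
    using zero by (subst UN, subst sum.insert) (auto simp: D'_def intro!: sum.union_disjoint)
  also have "\<dots> = card D * (2 * l + 2)"
    using lam mu cardD' by (simp add: algebra_simps)
  finally show cardD: "card D = 2 * l + 2"
    using \<open>D \<noteq> {}\<close> by (simp only: mult_cancel1) simp
  show "CARD('a) = 4 * l + 5" using card cardD cardD' by simp
qed

section \<open>The order of a primitive element\<close>

lemma primitive_element_nonzero: "primitive_element \<zeta> \<Longrightarrow> \<zeta> \<noteq> 0"
  unfolding primitive_element_def by (metis Diff_iff power_one_right rangeI singletonI)

text \<open>Primitivity is given through the range of the powers, so the order has to be computed:
  if d is the least positive exponent with value 1, the powers below d are distinct and exhaust all
  powers, hence d is the number of nonzero elements.\<close>

lemma primitive_element_power_eq_1:
  fixes \<zeta> :: "'a::{field,finite}"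
  assumes "primitive_element \<zeta>" "\<zeta> ^ n = 1"
  shows "CARD('a) - 1 dvd n"
proof -
  have nz: "\<zeta> \<noteq> 0" using assms(1) by (rule primitive_element_nonzero)
  have "\<not> inj (\<lambda>i::nat. \<zeta> ^ i)"
    using finite_imageD[of "\<lambda>i::nat. \<zeta> ^ i" UNIV] infinite_UNIV_nat by (auto simp: finite_subset)
  then obtain i j :: nat where "i < j" "\<zeta> ^ i = \<zeta> ^ j"
    unfolding inj_def by (metis linorder_neqE_nat)
  then have ex: "\<exists>d>0. \<zeta> ^ d = 1"
    using nz by (intro exI[of _ "j - i"]) (simp add: power_diff)
  define d where "d = (LEAST d. d > 0 \<and> \<zeta> ^ d = 1)"
  have d: "d > 0" "\<zeta> ^ d = 1" using LeastI_ex[OF ex] by (auto simp: d_def)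
  have least: "d \<le> e" if "e > 0" "\<zeta> ^ e = 1" for e
    using that Least_le[of "\<lambda>d. d > 0 \<and> \<zeta> ^ d = 1"] by (simp add: d_def)
  have red: "\<zeta> ^ (m mod d) = \<zeta> ^ m" for m
  proof -
    have "\<zeta> ^ m = \<zeta> ^ (d * (m div d) + m mod d)" by simp
    also have "\<dots> = \<zeta> ^ (m mod d)" by (simp only: power_add power_mult d(2)) simp
    finally show ?thesis by simp
  qed
  have "(\<lambda>i. \<zeta> ^ i) ` {..<d} = range (\<lambda>i::nat. \<zeta> ^ i)"
  proof (intro equalityI subsetI)
    fix y assume "y \<in> range (\<lambda>i::nat. \<zeta> ^ i)"
    then obtain m where "y = \<zeta> ^ (m mod d)" using red by auto
    then show "y \<in> (\<lambda>i. \<zeta> ^ i) ` {..<d}" using d(1) by auto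
  qed auto
  moreover have "inj_on (\<lambda>i. \<zeta> ^ i) {..<d}"
  proof (rule linorder_inj_onI)
    fix i j assume ij: "i < j" "i \<in> {..<d}" "j \<in> {..<d}"
    show "\<zeta> ^ i \<noteq> \<zeta> ^ j"
    proof
      assume "\<zeta> ^ i = \<zeta> ^ j"
      then have "\<zeta> ^ (j - i) = 1" using nz ij by (simp add: power_diff)
      with least[of "j - i"] ij show False by auto
    qed
  qed auto
  ultimately have "d = CARD('a) - 1"
    using assms(1) card_image[of "\<lambda>i. \<zeta> ^ i" "{..<d}"]
    by (simp add: primitive_element_def card_Diff_subset)
  moreover have "n mod d = 0"
    using least[of "n mod d"] red[of n] assms(2) d(1) mod_less_divisor[of d n] by fastforce
  ultimately show ?thesis by (simp add: dvd_eq_mod_eq_0)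
qed

section \<open>The Peisert graph as a Cayley graph\<close>

definition peisert_set :: "'a::{field,finite} \<Rightarrow> 'a set" where
  "peisert_set \<zeta> = {\<zeta> ^ i | i::nat. i mod 4 = 0 \<or> i mod 4 = 1}"

lemma peisert_graph_iff: "peisert_graph \<zeta> x y \<longleftrightarrow> y - x \<in> peisert_set \<zeta>"
  by (simp only: peisert_graph_def peisert_set_def cong_def mem_Collect_eq conj_commute) simp

context
  fixes \<zeta> :: "'a::{field,finite}"
  assumes prim: "primitive_element \<zeta>" and card8: "8 dvd CARD('a) - 1"
begin

lemma primitive_element_power_mod_4:
  assumes "\<zeta> ^ i = \<zeta> ^ j" shows "i mod 4 = j mod 4"
  using assms
proof (induction i j rule: linorder_wlog)
  case (le i j)
  then have "\<zeta> ^ (j - i) = 1"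
    using primitive_element_nonzero[OF prim] by (simp add: power_diff)
  then have "CARD('a) - 1 dvd j - i" by (rule primitive_element_power_eq_1[OF prim])
  with card8 have "8 dvd j - i" by (rule dvd_trans)
  then have "4 dvd j - i" by (rule dvd_trans[rotated]) simp
  with \<open>i \<le> j\<close> show ?case by (metis mod_eq_dvd_iff_nat)
qed metis

lemma power_mem_peisert_set: "\<zeta> ^ i \<in> peisert_set \<zeta> \<longleftrightarrow> i mod 4 = 0 \<or> i mod 4 = 1"
proof
  assume "\<zeta> ^ i \<in> peisert_set \<zeta>"
  then obtain j where "\<zeta> ^ i = \<zeta> ^ j" "j mod 4 = 0 \<or> j mod 4 = 1"
    unfolding peisert_set_def mem_Collect_eq by (elim exE conjE)
  then show "i mod 4 = 0 \<or> i mod 4 = 1" using primitive_element_power_mod_4[of i j] by simp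
next
  assume "i mod 4 = 0 \<or> i mod 4 = 1"
  then show "\<zeta> ^ i \<in> peisert_set \<zeta>"
    unfolding peisert_set_def mem_Collect_eq by (intro exI[of _ i] conjI refl)
qed

lemma nonzero_eq_power: "x \<noteq> 0 \<Longrightarrow> \<exists>i. x = \<zeta> ^ i"
  using prim unfolding primitive_element_def by blast

text \<open>Adding 2 to the exponent interchanges the classes {0,1} and {2,3} modulo 4.\<close>

lemma peisert_set_complement:
  assumes "x \<noteq> 0" shows "\<zeta>\<^sup>2 * x \<in> peisert_set \<zeta> \<longleftrightarrow> x \<notin> peisert_set \<zeta>"
proof -
  from assms obtain i where "x = \<zeta> ^ i" using nonzero_eq_power by blast
  moreover have "\<zeta>\<^sup>2 * \<zeta> ^ i = \<zeta> ^ (2 + i)" by (simp only: power_add)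
  ultimately show ?thesis
    by (simp only: power_mem_peisert_set) presburger
qed

text \<open>Divisibility by 8, and not only by 4, makes -1 a fourth power: if -1 is the j-th power
  of \<zeta>, then 8 divides 2j. This makes the graph undirected.\<close>

lemma peisert_set_uminus:
  assumes "x \<in> peisert_set \<zeta>" shows "- x \<in> peisert_set \<zeta>"
proof -
  obtain j where j: "-1 = \<zeta> ^ j" using nonzero_eq_power[of "-1"] by auto
  then have "\<zeta> ^ (2 * j) = 1" by (metis power_even_eq power2_minus power_one)
  then have "8 dvd 2 * j" using primitive_element_power_eq_1[OF prim] card8 dvd_trans by blast
  then have j4: "j mod 4 = 0" by presburger
  obtain i where i: "x = \<zeta> ^ i" "i mod 4 = 0 \<or> i mod 4 = 1"
    using assms by (auto simp: peisert_set_def)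
  have "- x = \<zeta> ^ (j + i)" by (simp add: power_add i flip: j)
  moreover have "(j + i) mod 4 = 0 \<or> (j + i) mod 4 = 1" using i(2) j4 by presburger
  ultimately show ?thesis by (simp add: power_mem_peisert_set)
qed

lemma zero_notin_peisert_set: "0 \<notin> peisert_set \<zeta>"
  using primitive_element_nonzero[OF prim] by (auto simp: peisert_set_def)

lemma peisert_graph_card_le:
  assumes T: "terwilliger_T0 (peisert_graph \<zeta>) \<omega> = terwilliger_algebra (peisert_graph \<zeta>) \<omega>"
  shows "CARD('a) \<le> 9"
proof -
  define E where "E = peisert_graph \<zeta>"
  define D where "D = peisert_set \<zeta>"
  have E: "E x y \<longleftrightarrow> y - x \<in> D" for x y by (simp add: E_def D_def peisert_graph_iff)
  have sym: "E x y \<Longrightarrow> E y x" for x y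
    using peisert_set_uminus[of "y - x"] by (simp add: E D_def)
  have irr: "\<not> E x x" for x using zero_notin_peisert_set by (simp add: E D_def)
  have count: "card {z. E x z \<and> E \<omega> z \<and> E z y} = card {z. E x' z \<and> E \<omega> z \<and> E z y'}"
    if "same_type E \<omega> x \<omega> x'" "same_type E \<omega> y \<omega> y'" "same_type E x y x' y'" for x y x' y'
    using triple_count_same_type[of E, OF _ that] T by (simp add: E_def)
  have "1 \<in> D" using power_mem_peisert_set[of 0] by (simp add: D_def)
  define l where "l = card {z. E \<omega> z \<and> E z (\<omega> + 1)}"
  \<comment> \<open>For x = \<omega> the triple count is the number of common neighbours of \<omega>
    and y. Hence the constancy of \<lambda> also comes from \<open>T\<close>, without cyclotomic
    numbers. The reference neighbour \<open>\<omega> + 1\<close> exists because 1 is the zeroth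
    power of \<zeta>.\<close>
  have lam\<omega>: "card {z. E \<omega> z \<and> E z y} = l" if "E \<omega> y" for y
  proof -
    have "E \<omega> (\<omega> + 1)" using \<open>1 \<in> D\<close> by (simp add: E)
    then show ?thesis
      using count[of \<omega> \<omega> y "\<omega> + 1"] that irr by (auto simp: same_type_def l_def)
  qed
  have lamD: "card {z \<in> D. z - s \<in> D} = l" if "s \<in> D" for s
  proof -
    have "bij_betw ((+) \<omega>) {z \<in> D. z - s \<in> D} {z. E \<omega> z \<and> E z (\<omega> + s)}"
      by (rule bij_betw_byWitness[of _ "\<lambda>z. z - \<omega>"])
        (use peisert_set_uminus in \<open>fastforce simp: E D_def algebra_simps\<close>)+
    from bij_betw_same_card[OF this] show ?thesis using lam\<omega>[of "\<omega> + s"] that by (simp add: E)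
  qed
  have "D \<noteq> {}" using \<open>1 \<in> D\<close> by auto
  have "\<zeta>\<^sup>2 \<noteq> 0" using primitive_element_nonzero[OF prim] by simp
  note cards = self_complementary_set_card[OF zero_notin_peisert_set peisert_set_uminus
      \<open>D \<noteq> {}\<close>[unfolded D_def] peisert_set_complement this lamD[unfolded D_def],
      folded D_def]
  have reg: "card {z. E x z} = 2 * l + 2" for x
  proof -
    have "bij_betw (\<lambda>z. z - x) {z. E x z} D"
      by (rule bij_betw_byWitness[of _ "\<lambda>z. z + x"]) (auto simp: E)
    from bij_betw_same_card[OF this] show ?thesis using cards by simp
  qed
  have lam: "card {z. E x z \<and> E y z} = l" if "E x y" for x y
  proof -
    have "bij_betw (\<lambda>z. z - x) {z. E x z \<and> E y z} {z \<in> D. z - (y - x) \<in> D}"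
      by (rule bij_betw_byWitness[of _ "\<lambda>z. z + x"]) (auto simp: E algebra_simps)
    from bij_betw_same_card[OF this] show ?thesis using lamD[of "y - x"] that by (simp add: E)
  qed
  have "\<exists>e. \<forall>x y. E \<omega> x \<and> E \<omega> y \<and> E x y \<longrightarrow>
      card {z. E x z \<and> E \<omega> z \<and> E z y} = e"
  proof (rule constant_on_pairs)
    fix x y x' y' assume "E \<omega> x \<and> E \<omega> y \<and> E x y" "E \<omega> x' \<and> E \<omega> y' \<and> E x' y'"
    with irr show "card {z. E x z \<and> E \<omega> z \<and> E z y} = card {z. E x' z \<and> E \<omega> z \<and> E z y'}"
      by (intro count) (auto simp: same_type_def)
  qed
  then obtain e where e: "\<forall>x y. E \<omega> x \<and> E \<omega> y \<and> E x y \<longrightarrow>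
      card {z. E x z \<and> E \<omega> z \<and> E z y} = e" by blast
  have "\<exists>c. \<forall>x y. E \<omega> x \<and> E \<omega> y \<and> x \<noteq> y \<and> \<not> E x y \<longrightarrow>
      card {z. E x z \<and> E \<omega> z \<and> E z y} = c"
  proof (rule constant_on_pairs)
    fix x y x' y' assume "E \<omega> x \<and> E \<omega> y \<and> x \<noteq> y \<and> \<not> E x y"
      "E \<omega> x' \<and> E \<omega> y' \<and> x' \<noteq> y' \<and> \<not> E x' y'"
    with irr show "card {z. E x z \<and> E \<omega> z \<and> E z y} = card {z. E x' z \<and> E \<omega> z \<and> E z y'}"
      by (intro count) (auto simp: same_type_def)
  qed
  then obtain c where c: "\<forall>x y. E \<omega> x \<and> E \<omega> y \<and> x \<noteq> y \<and> \<not> E x y \<longrightarrow>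
      card {z. E x z \<and> E \<omega> z \<and> E z y} = c" by blast
  have "l \<le> 1"
    by (rule conference_graph_locally_regular[where \<omega> = \<omega> and e = e and c = c,
          OF sym irr cards(2) reg lam]) (simp_all add: e c)
  then show ?thesis using cards by simp
qed

end

section \<open>Conclusion for fields whose order is an odd square\<close>

lemma odd_square_mod_8:
  fixes n :: nat
  assumes "odd n" shows "8 dvd n\<^sup>2 - 1"
proof -
  obtain k where "n = 2 * k + 1" using assms oddE by blast
  moreover have "even (k * (k + 1))" by simp
  then obtain j where "k * (k + 1) = 2 * j" by blast
  ultimately have "n\<^sup>2 - 1 = 8 * j" by (simp add: power2_eq_square algebra_simps)
  then show ?thesis by simp
qed

theorem theorem6p4:
  fixes p t :: nat and \<zeta> :: "'a::{field,finite}"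
  assumes "prime p" and "[p = 3] (mod 4)" and "t \<ge> 1"
    and "CARD('a) = p ^ (2 * t)"
    and "primitive_element \<zeta>"
    and "triply_transitive (peisert_graph \<zeta>)"
  shows "(p, t) = (3, 1)"
proof -
  have q: "CARD('a) = (p ^ t)\<^sup>2" using assms(4) by (simp add: power_mult mult.commute)
  have p: "p mod 4 = 3" using assms(2) by (simp add: cong_def)
  then have "odd p" and p3: "p \<ge> 3" by presburger+
  then have "8 dvd CARD('a) - 1" unfolding q by (intro odd_square_mod_8) simp
  with assms(5,6) have "(p ^ t)\<^sup>2 \<le> 3\<^sup>2"
    unfolding triply_transitive_def q[symmetric] using peisert_graph_card_le by auto
  then have le: "p ^ t \<le> 3" by (simp only: power2_nat_le_eq_le)
  have "p ^ 1 \<le> p ^ t" using assms(3) p3 by (intro power_increasing) auto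
  with le p3 have "p = 3" by simp
  moreover have "t = 1"
  proof (rule ccontr)
    assume "t \<noteq> 1"
    then have "(3::nat) ^ 2 \<le> 3 ^ t" using assms(3) by (intro power_increasing) auto
    with le \<open>p = 3\<close> show False by simp
  qed
  ultimately show ?thesis by simp
qed

end
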